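(* Let $(g,[\cdot,\cdot],\omega)$ be an $\omega$-Lie superalgebra over a field $\mathbb{K}$ of characteristic zero with $\mathrm{Z}(g)=\{0\}$, let $U$ be a $\mathbb{Z}_2$-graded subspace with $g=[g,g]\oplus U$, and let $\breve g$ (with bracket and bilinear form $\breve\omega$) and $\varphi:\mathrm{QDer}(g)\to\mathrm{End}(\breve g)$ be as defined in the context. Then $$\mathrm{Der}^{\omega}(\breve g)=\varphi(\mathrm{QDer}^{\omega}(g))\oplus \mathrm{ZDer}(\breve g).$$
   Context: $\mathbb{K}$ is a field of characteristic zero. An $\omega$-Lie superalgebra is a $\mathbb{Z}_2$-graded $\mathbb{K}$-vector space $g=g_{\bar 0}\oplus g_{\bar 1}$ with a bilinear bracket $[\cdot,\cdot]:g\times g\to g$ and a bilinear form $\omega:g\times g\to\mathbb{K}$ such that, for all $\alpha,\beta\in\mathbb{Z}_2$ and all homogeneous $x,y,z\in g$ (with $|x|\in\mathbb{Z}_2$ the degree of $x$): (1) $[g_\alpha,g_\beta]\subseteq g_{\alpha+\beta}$; (2) $[x,y]=-(-1)^{|x||y|}[y,x]$; (3) $(-1)^{|x||y|}[[y,z],x]+(-1)^{|y||z|}[[z,x],y]+(-1)^{|x||z|}[[x,y],z]=(-1)^{|x||y|}\omega(y,z)x+(-1)^{|y||z|}\omega(z,x)y+(-1)^{|x||z|}\omega(x,y)z$; (4) $\omega(g_{\bar 0},g_{\bar 1})=0$. The center is $\mathrm{Z}(g)=\{x\in g:[x,y]=0\ \text{for all } y\in g\}$, and $[g,g]$ is the span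 of all brackets. Construction of $\breve g$: let $t$ be an indeterminate and $\breve g=g\otimes t\,\mathbb{K}[t]/(t^3)=gt\oplus gt^2$ (write $xt^i$ for $x\otimes t^i$), graded by $\breve g_\alpha=g_\alpha t\oplus g_\alpha t^2$, with bracket determined by $[xt,yt]=[x,y]t^2$ and $[xt^i,yt^j]=0$ for all other $i,j\in\{1,2\}$, and bilinear form determined by $\breve\omega(xt,yt)=\omega(x,y)$ and $\breve\omega(xt^i,yt^j)=0$ for all other $i,j\in\{1,2\}$. Maps: let $(A,[\cdot,\cdot],\omega_A)$ be $g$ with $\omega$ or $\breve g$ with $\breve\omega$. All conditions are for homogeneous $x\in A$ and all $y\in A$. A homogeneous linear map $d:A\to A$ of degree $|d|$ is: a derivation if $d([x,y])=[d(x),y]+(-1)^{|d||x|}[x,d(y)]$; a quasiderivation if there is a linear map $d'$ homogeneous of degree $|d|$ with $d'([x,y])=[d(x),y]+(-1)^{|d||x|}[x,d(y)]$; a center derivation if $[d(x),y]=d([x,y])=0$; compatible if $\omega_A(d(x),y)+(-1)^{|d||x|}\omega_A(x,d(y))=0$. $\mathrm{Der}(A)$, $\mathrm{QDer}(A)$, $\mathrm{ZDer}(A)$ are the graded subspaces of $\mathrm{End}(A)$ spanned by the homogeneous derivations, quasiderivations, center derivations; $\mathrm{Der}^{\omega}(A)$, $\mathrm{QDer}^{\omega}(A)$ are the graded subspaces spanned by the compatible homogeneous derivations, respectively compatible homogeneous quasiderivations. The map $\varphi$: one has $\breve g=gt\oplus[g,g]t^2\oplus Ut^2$. For a homogeneous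 quasiderivation $d$ of $g$ with associated map $d'$ (as in the definition of quasiderivation), $\varphi(d)(at+bt^2+ut^2)=d(a)t+d'(b)t^2$ for $a\in g$, $b\in[g,g]$, $u\in U$; $\varphi$ is extended linearly to $\mathrm{QDer}(g)$. *)

theory Defs
  imports "HOL-Analysis.Product_Vector" "HOL-Library.Z2" "HOL-Library.Function_Algebras"
begin

text \<open>
  A vector space over the field \<open>'k\<close> is a whole type \<open>'v\<close> with a scalar multiplication satisfying
  \<^locale>\<open>vector_space\<close>. Degrees in $\mathbb{Z}_2$ are elements of \<^typ>\<open>bit\<close>, and a grading is the family
  of its homogeneous components, \<open>G 0\<close> and \<open>G 1\<close>. Endomorphisms are functions
  \<open>'v \<Rightarrow> 'v\<close>, added pointwise.
\<close>

definition fun_scale :: "('k \<Rightarrow> 'w \<Rightarrow> 'w) \<Rightarrow> 'k \<Rightarrow> ('v \<Rightarrow> 'w) \<Rightarrow> ('v \<Rightarrow> 'w)"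
  where "fun_scale s c f = (\<lambda>x. s c (f x))"

text \<open>\<open>direct_sum s C A B\<close>: \<open>C\<close> is the internal direct sum of the subspaces \<open>A\<close> and \<open>B\<close>.\<close>

definition direct_sum ::
    "('k::field \<Rightarrow> 'v::ab_group_add \<Rightarrow> 'v) \<Rightarrow> 'v set \<Rightarrow> 'v set \<Rightarrow> 'v set \<Rightarrow> bool"
  where "direct_sum s C A B \<longleftrightarrow>
    module.subspace s A \<and> module.subspace s B \<and> A \<inter> B = {0} \<and> C = {a + b | a b. a \<in> A \<and> b \<in> B}"

text \<open>The component in \<open>A\<close> of \<open>c\<close>, for a direct sum of \<open>A\<close> and \<open>B\<close>.\<close>

definition proj_along :: "'v::ab_group_add set \<Rightarrow> 'v set \<Rightarrow> 'v \<Rightarrow> 'v"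
  where "proj_along A B c = (THE a. a \<in> A \<and> c - a \<in> B)"

definition graded_subspace ::
    "('k::field \<Rightarrow> 'v::ab_group_add \<Rightarrow> 'v) \<Rightarrow> (bit \<Rightarrow> 'v set) \<Rightarrow> 'v set \<Rightarrow> bool"
  where "graded_subspace s G U \<longleftrightarrow>
    module.subspace s U \<and> U = {u + v | u v. u \<in> U \<inter> G 0 \<and> v \<in> U \<inter> G 1}"

text \<open>The sign $(-1)^{\alpha\beta}$.\<close>

definition ksign :: "bit \<Rightarrow> bit \<Rightarrow> 'k::comm_ring_1"
  where "ksign \<alpha> \<beta> = (if \<alpha> * \<beta> = 1 then -1 else 1)"

locale omega_lie_superalgebra = vector_space scale
  for scale :: "'k::field_char_0 \<Rightarrow> 'v::ab_group_add \<Rightarrow> 'v" (infixr \<open>*s\<close> 75) +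
  fixes G :: "bit \<Rightarrow> 'v set"
    and br :: "'v \<Rightarrow> 'v \<Rightarrow> 'v"
    and om :: "'v \<Rightarrow> 'v \<Rightarrow> 'k"
  assumes grading: "direct_sum scale UNIV (G 0) (G 1)"
    and br_linear_left: "\<And>y. Vector_Spaces.linear scale scale (\<lambda>x. br x y)"
    and br_linear_right: "\<And>x. Vector_Spaces.linear scale scale (\<lambda>y. br x y)"
    and om_linear_left: "\<And>y. Vector_Spaces.linear scale (*) (\<lambda>x. om x y)"
    and om_linear_right: "\<And>x. Vector_Spaces.linear scale (*) (\<lambda>y. om x y)"
    and br_graded: "\<And>\<alpha> \<beta> x y. x \<in> G \<alpha> \<Longrightarrow> y \<in> G \<beta> \<Longrightarrow> br x y \<in> G (\<alpha> + \<beta>)"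
    and br_skew: "\<And>\<alpha> \<beta> x y. x \<in> G \<alpha> \<Longrightarrow> y \<in> G \<beta> \<Longrightarrow> br x y = - (ksign \<alpha> \<beta> *s br y x)"
    and omega_jacobi: "\<And>\<alpha> \<beta> \<gamma> x y z. x \<in> G \<alpha> \<Longrightarrow> y \<in> G \<beta> \<Longrightarrow> z \<in> G \<gamma> \<Longrightarrow>
        ksign \<alpha> \<beta> *s br (br y z) x + ksign \<beta> \<gamma> *s br (br z x) y + ksign \<alpha> \<gamma> *s br (br x y) z =
        (ksign \<alpha> \<beta> * om y z) *s x + (ksign \<beta> \<gamma> * om z x) *s y + (ksign \<alpha> \<gamma> * om x y) *s z"
    and om_graded: "\<And>x y. x \<in> G 0 \<Longrightarrow> y \<in> G 1 \<Longrightarrow> om x y = 0"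

definition center :: "('v \<Rightarrow> 'v \<Rightarrow> 'v::zero) \<Rightarrow> 'v set"
  where "center br = {x. \<forall>y. br x y = 0}"

definition derived ::
    "('k::field \<Rightarrow> 'v::ab_group_add \<Rightarrow> 'v) \<Rightarrow> ('v \<Rightarrow> 'v \<Rightarrow> 'v) \<Rightarrow> 'v set"
  where "derived s br = module.span s {br x y | x y. True}"

text \<open>
  The notions below make sense for any graded space with a bracket and a form. They are not tied
  to the locale, since the form on the algebra constructed from \<open>g\<close> need not satisfy its axioms.
\<close>

definition homogeneous_map ::
    "('k::field \<Rightarrow> 'v::ab_group_add \<Rightarrow> 'v) \<Rightarrow> (bit \<Rightarrow> 'v set) \<Rightarrow> bit \<Rightarrow> ('v \<Rightarrow> 'v) \<Rightarrow> bool"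
  where "homogeneous_map s G \<gamma> d \<longleftrightarrow>
    Vector_Spaces.linear s s d \<and> (\<forall>\<alpha>. \<forall>x\<in>G \<alpha>. d x \<in> G (\<gamma> + \<alpha>))"

definition derivation ::
    "('k::field \<Rightarrow> 'v::ab_group_add \<Rightarrow> 'v) \<Rightarrow> (bit \<Rightarrow> 'v set) \<Rightarrow> ('v \<Rightarrow> 'v \<Rightarrow> 'v) \<Rightarrow>
     bit \<Rightarrow> ('v \<Rightarrow> 'v) \<Rightarrow> bool"
  where "derivation s G br \<gamma> d \<longleftrightarrow> homogeneous_map s G \<gamma> d \<and>
    (\<forall>\<alpha>. \<forall>x\<in>G \<alpha>. \<forall>y. d (br x y) = br (d x) y + s (ksign \<gamma> \<alpha>) (br x (d y)))"

text \<open>\<open>d'\<close> is a map associated with the quasiderivation \<open>d\<close>.\<close>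

definition quasiderivation_with ::
    "('k::field \<Rightarrow> 'v::ab_group_add \<Rightarrow> 'v) \<Rightarrow> (bit \<Rightarrow> 'v set) \<Rightarrow> ('v \<Rightarrow> 'v \<Rightarrow> 'v) \<Rightarrow>
     bit \<Rightarrow> ('v \<Rightarrow> 'v) \<Rightarrow> ('v \<Rightarrow> 'v) \<Rightarrow> bool"
  where "quasiderivation_with s G br \<gamma> d d' \<longleftrightarrow>
    homogeneous_map s G \<gamma> d \<and> homogeneous_map s G \<gamma> d' \<and>
    (\<forall>\<alpha>. \<forall>x\<in>G \<alpha>. \<forall>y. d' (br x y) = br (d x) y + s (ksign \<gamma> \<alpha>) (br x (d y)))"

definition quasiderivation ::
    "('k::field \<Rightarrow> 'v::ab_group_add \<Rightarrow> 'v) \<Rightarrow> (bit \<Rightarrow> 'v set) \<Rightarrow> ('v \<Rightarrow> 'v \<Rightarrow> 'v) \<Rightarrow>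
     bit \<Rightarrow> ('v \<Rightarrow> 'v) \<Rightarrow> bool"
  where "quasiderivation s G br \<gamma> d \<longleftrightarrow> (\<exists>d'. quasiderivation_with s G br \<gamma> d d')"

definition center_derivation ::
    "('k::field \<Rightarrow> 'v::ab_group_add \<Rightarrow> 'v) \<Rightarrow> (bit \<Rightarrow> 'v set) \<Rightarrow> ('v \<Rightarrow> 'v \<Rightarrow> 'v) \<Rightarrow>
     bit \<Rightarrow> ('v \<Rightarrow> 'v) \<Rightarrow> bool"
  where "center_derivation s G br \<gamma> d \<longleftrightarrow> homogeneous_map s G \<gamma> d \<and>
    (\<forall>\<alpha>. \<forall>x\<in>G \<alpha>. \<forall>y. br (d x) y = 0 \<and> d (br x y) = 0)"

definition compatible ::
    "(bit \<Rightarrow> 'v set) \<Rightarrow> ('v \<Rightarrow> 'v \<Rightarrow> 'k::field) \<Rightarrow> bit \<Rightarrow> ('v \<Rightarrow> 'v) \<Rightarrow> bool"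
  where "compatible G om \<gamma> d \<longleftrightarrow>
    (\<forall>\<alpha>. \<forall>x\<in>G \<alpha>. \<forall>y. om (d x) y + ksign \<gamma> \<alpha> * om x (d y) = 0)"

definition QDer ::
    "('k::field \<Rightarrow> 'v::ab_group_add \<Rightarrow> 'v) \<Rightarrow> (bit \<Rightarrow> 'v set) \<Rightarrow> ('v \<Rightarrow> 'v \<Rightarrow> 'v) \<Rightarrow> ('v \<Rightarrow> 'v) set"
  where "QDer s G br = module.span (fun_scale s) {d. \<exists>\<gamma>. quasiderivation s G br \<gamma> d}"

definition ZDer ::
    "('k::field \<Rightarrow> 'v::ab_group_add \<Rightarrow> 'v) \<Rightarrow> (bit \<Rightarrow> 'v set) \<Rightarrow> ('v \<Rightarrow> 'v \<Rightarrow> 'v) \<Rightarrow> ('v \<Rightarrow> 'v) set"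
  where "ZDer s G br = module.span (fun_scale s) {d. \<exists>\<gamma>. center_derivation s G br \<gamma> d}"

definition Der_omega ::
    "('k::field \<Rightarrow> 'v::ab_group_add \<Rightarrow> 'v) \<Rightarrow> (bit \<Rightarrow> 'v set) \<Rightarrow> ('v \<Rightarrow> 'v \<Rightarrow> 'v) \<Rightarrow>
     ('v \<Rightarrow> 'v \<Rightarrow> 'k) \<Rightarrow> ('v \<Rightarrow> 'v) set"
  where "Der_omega s G br om =
    module.span (fun_scale s) {d. \<exists>\<gamma>. derivation s G br \<gamma> d \<and> compatible G om \<gamma> d}"

definition QDer_omega ::
    "('k::field \<Rightarrow> 'v::ab_group_add \<Rightarrow> 'v) \<Rightarrow> (bit \<Rightarrow> 'v set) \<Rightarrow> ('v \<Rightarrow> 'v \<Rightarrow> 'v) \<Rightarrow>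
     ('v \<Rightarrow> 'v \<Rightarrow> 'k) \<Rightarrow> ('v \<Rightarrow> 'v) set"
  where "QDer_omega s G br om =
    module.span (fun_scale s) {d. \<exists>\<gamma>. quasiderivation s G br \<gamma> d \<and> compatible G om \<gamma> d}"

text \<open>
  The space $g \otimes t\,\mathbb{K}[t]/(t^3) = gt \oplus gt^2$ is \<open>'v \<times> 'v\<close>, the pair \<open>(x, y)\<close> standing for
  $xt + yt^2$.
\<close>

definition breve_scale ::
    "('k::field \<Rightarrow> 'v::ab_group_add \<Rightarrow> 'v) \<Rightarrow> 'k \<Rightarrow> 'v \<times> 'v \<Rightarrow> 'v \<times> 'v"
  where "breve_scale s = module_prod.scale s s"

definition breve_grading :: "(bit \<Rightarrow> 'v set) \<Rightarrow> bit \<Rightarrow> ('v \<times> 'v) set"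
  where "breve_grading G \<alpha> = G \<alpha> \<times> G \<alpha>"

definition breve_br :: "('v \<Rightarrow> 'v \<Rightarrow> 'v::zero) \<Rightarrow> 'v \<times> 'v \<Rightarrow> 'v \<times> 'v \<Rightarrow> 'v \<times> 'v"
  where "breve_br br p q = (0, br (fst p) (fst q))"

definition breve_om :: "('v \<Rightarrow> 'v \<Rightarrow> 'k) \<Rightarrow> 'v \<times> 'v \<Rightarrow> 'v \<times> 'v \<Rightarrow> 'k"
  where "breve_om om p q = om (fst p) (fst q)"

text \<open>The map $at + bt^2 + ut^2 \mapsto d(a)t + d'(b)t^2$ for $b \in [g,g]$ and $u \in U$.\<close>

definition phi_hom ::
    "('k::field \<Rightarrow> 'v::ab_group_add \<Rightarrow> 'v) \<Rightarrow> ('v \<Rightarrow> 'v \<Rightarrow> 'v) \<Rightarrow> 'v set \<Rightarrow>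
     ('v \<Rightarrow> 'v) \<Rightarrow> ('v \<Rightarrow> 'v) \<Rightarrow> 'v \<times> 'v \<Rightarrow> 'v \<times> 'v"
  where "phi_hom s br U d d' = (\<lambda>(a, c). (d a, d' (proj_along (derived s br) U c)))"

text \<open>
  A quasiderivation in \<open>QDer\<close> is the sum of its even and odd components, and its image is the sum of
  their images. The lemmas \<open>phi_homogeneous\<close> and \<open>phi_linear\<close> below show that this is the linear
  extension to \<open>QDer\<close> of the defining formula for homogeneous quasiderivations; outside of \<open>QDer\<close>
  the value is unspecified.
\<close>

definition phi ::
    "('k::field \<Rightarrow> 'v::ab_group_add \<Rightarrow> 'v) \<Rightarrow> (bit \<Rightarrow> 'v set) \<Rightarrow> ('v \<Rightarrow> 'v \<Rightarrow> 'v) \<Rightarrow> 'v set \<Rightarrow>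
     ('v \<Rightarrow> 'v) \<Rightarrow> 'v \<times> 'v \<Rightarrow> 'v \<times> 'v"
  where "phi s G br U d = (THE F. \<exists>d\<^sub>0 d\<^sub>0' d\<^sub>1 d\<^sub>1'.
    quasiderivation_with s G br 0 d\<^sub>0 d\<^sub>0' \<and> quasiderivation_with s G br 1 d\<^sub>1 d\<^sub>1' \<and>
    d = d\<^sub>0 + d\<^sub>1 \<and> F = phi_hom s br U d\<^sub>0 d\<^sub>0' + phi_hom s br U d\<^sub>1 d\<^sub>1')"

context omega_lie_superalgebra
begin

lemma ksign_simps [simp]: "ksign 0 \<alpha> = (1::'k)" "ksign \<alpha> 0 = (1::'k)" "ksign 1 1 = (-1::'k)"
  by (simp_all add: ksign_def)

lemma vs_fun: "vector_space (fun_scale scale :: 'k \<Rightarrow> ('a \<Rightarrow> 'v) \<Rightarrow> 'a \<Rightarrow> 'v)"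
  by unfold_locales
    (auto simp: fun_scale_def fun_eq_iff scale_right_distrib scale_left_distrib)

sublocale fs: vector_space "fun_scale scale :: 'k \<Rightarrow> ('v \<Rightarrow> 'v) \<Rightarrow> 'v \<Rightarrow> 'v"
  by (rule vs_fun)

lemma linear_iff: "Vector_Spaces.linear scale scale f \<longleftrightarrow>
    (\<forall>x y. f (x + y) = f x + f y) \<and> (\<forall>c x. f (c *s x) = c *s f x)"
  by (auto simp: Vector_Spaces.linear_iff vector_space_axioms)

lemma br_add: "br (x + y) z = br x z + br y z" "br z (x + y) = br z x + br z y"
  and br_scale: "br (c *s x) z = c *s br x z" "br z (c *s x) = c *s br z x"
  using br_linear_left[of z] br_linear_right[of z] by (simp_all add: linear_iff)

lemma sub_G: "subspace (G \<alpha>)"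
  using grading by (cases \<alpha>) (auto simp: direct_sum_def)

lemma G_split: obtains x\<^sub>0 x\<^sub>1 where "x\<^sub>0 \<in> G 0" "x\<^sub>1 \<in> G 1" "x = x\<^sub>0 + x\<^sub>1"
proof -
  have "x \<in> {a + b | a b. a \<in> G 0 \<and> b \<in> G 1}" using grading by (simp add: direct_sum_def)
  with that show ?thesis by blast
qed

lemma G_cancel:
  assumes "a \<in> G 0" "b \<in> G 1" "a' \<in> G 0" "b' \<in> G 1" "a + b = a' + b'"
  shows "a = a' \<and> b = b'"
proof -
  have "a - a' \<in> G 0" using assms sub_G by (simp add: subspace_diff)
  moreover have "a - a' = b' - b" using assms(5) by (simp add: algebra_simps)
  moreover have "b' - b \<in> G 1" using assms sub_G by (simp add: subspace_diff)
  ultimately have "a - a' \<in> G 0 \<inter> G 1" by auto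
  then have "a - a' = 0" using grading unfolding direct_sum_def by blast
  then show ?thesis using assms(5) by simp
qed

lemma homogeneous_map_linear:
  assumes "homogeneous_map scale G \<gamma> d"
  shows "d (x + y) = d x + d y" "d (c *s x) = c *s d x"
  using assms by (auto simp: homogeneous_map_def linear_iff)

lemma homogeneous_decomp_unique:
  assumes d: "homogeneous_map scale G 0 d\<^sub>0" "homogeneous_map scale G 1 d\<^sub>1"
    and e: "homogeneous_map scale G 0 e\<^sub>0" "homogeneous_map scale G 1 e\<^sub>1"
    and eq: "d\<^sub>0 + d\<^sub>1 = e\<^sub>0 + e\<^sub>1"
  shows "d\<^sub>0 = e\<^sub>0 \<and> d\<^sub>1 = e\<^sub>1"
proof -
  have eq': "d\<^sub>0 x + d\<^sub>1 x = e\<^sub>0 x + e\<^sub>1 x" for x using eq by (metis plus_fun_apply)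
  have A: "d\<^sub>0 x = e\<^sub>0 x \<and> d\<^sub>1 x = e\<^sub>1 x" if "x \<in> G \<alpha>" for x \<alpha>
  proof (cases "\<alpha> = 0")
    case True
    then show ?thesis
      using that d e eq' G_cancel[of "d\<^sub>0 x" "d\<^sub>1 x" "e\<^sub>0 x" "e\<^sub>1 x"]
      by (force simp: homogeneous_map_def)
  next
    case False
    then have 1: "\<alpha> = 1" by simp
    have "d\<^sub>1 x + d\<^sub>0 x = e\<^sub>1 x + e\<^sub>0 x" using eq'[of x] by (simp add: add.commute)
    moreover have "d\<^sub>1 x \<in> G (1 + 1)" "e\<^sub>1 x \<in> G (1 + 1)" "d\<^sub>0 x \<in> G (0 + 1)" "e\<^sub>0 x \<in> G (0 + 1)"
      using that 1 d e unfolding homogeneous_map_def by blast+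
    ultimately show ?thesis
      using G_cancel[of "d\<^sub>1 x" "d\<^sub>0 x" "e\<^sub>1 x" "e\<^sub>0 x"] by simp
  qed
  have "d\<^sub>0 x = e\<^sub>0 x \<and> d\<^sub>1 x = e\<^sub>1 x" for x
    by (rule G_split[of x])
      (use A d e in \<open>metis homogeneous_map_linear(1)\<close>)
  then show ?thesis by auto
qed

lemma quasiderivation_with_unique:
  assumes "quasiderivation_with scale G br \<gamma> d d'" "quasiderivation_with scale G br \<gamma> d d''"
    and "b \<in> derived scale br"
  shows "d' b = d'' b"
proof -
  have lin: "homogeneous_map scale G \<gamma> d'" "homogeneous_map scale G \<gamma> d''"
    using assms by (auto simp: quasiderivation_with_def)
  then have ll: "Vector_Spaces.linear scale scale d'" "Vector_Spaces.linear scale scale d''"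
    by (auto simp: homogeneous_map_def)
  have H: "d' (br x y) = d'' (br x y)" if "x \<in> G \<alpha>" for x y \<alpha>
    using assms(1,2) that by (simp add: quasiderivation_with_def)
  have "d' (br x y) = d'' (br x y)" for x y
    by (rule G_split[of x])
      (use H lin in \<open>simp add: br_add homogeneous_map_linear(1)[of \<gamma>]\<close>)
  then show ?thesis
    using assms(3) vector_space_pair.linear_eq_on_span[OF _ ll, of "{br x y |x y. True}" b]
    by (auto simp: derived_def vector_space_pair_def vector_space_axioms)
qed

lemma quasiderivation_with_0: "quasiderivation_with scale G br \<gamma> 0 0"
  using br_scale(1)[of 0] br_scale(2)[of _ 0]
  by (auto simp: quasiderivation_with_def homogeneous_map_def linear_iff subspace_0[OF sub_G])

lemma quasiderivation_with_add:
  assumes "quasiderivation_with scale G br \<gamma> d d'" "quasiderivation_with scale G br \<gamma> e e'"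
  shows "quasiderivation_with scale G br \<gamma> (d + e) (d' + e')"
  using assms
  by (auto simp: quasiderivation_with_def homogeneous_map_def linear_iff
      subspace_add[OF sub_G] scale_right_distrib br_add)

lemma quasiderivation_with_scale:
  assumes "quasiderivation_with scale G br \<gamma> d d'"
  shows "quasiderivation_with scale G br \<gamma> (fun_scale scale c d) (fun_scale scale c d')"
  using assms
  by (auto simp: quasiderivation_with_def homogeneous_map_def linear_iff fun_scale_def
      subspace_scale[OF sub_G] scale_right_distrib br_scale mult.commute)

lemma QDer_decomp:
  assumes "d \<in> QDer scale G br"
  obtains d\<^sub>0 d\<^sub>0' d\<^sub>1 d\<^sub>1' where "quasiderivation_with scale G br 0 d\<^sub>0 d\<^sub>0'"
    "quasiderivation_with scale G br 1 d\<^sub>1 d\<^sub>1'" "d = d\<^sub>0 + d\<^sub>1"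
proof -
  have "\<exists>d\<^sub>0 d\<^sub>0' d\<^sub>1 d\<^sub>1'. quasiderivation_with scale G br 0 d\<^sub>0 d\<^sub>0' \<and>
      quasiderivation_with scale G br 1 d\<^sub>1 d\<^sub>1' \<and> d = d\<^sub>0 + d\<^sub>1"
    using assms unfolding QDer_def
  proof (induction rule: fs.span_induct_alt)
    case base
    show ?case using quasiderivation_with_0 by (metis add_0)
  next
    case (step c x y)
    then obtain \<gamma> x' where x: "quasiderivation_with scale G br \<gamma> x x'"
      by (auto simp: quasiderivation_def)
    note x = quasiderivation_with_scale[OF x, of c]
    from step obtain d\<^sub>0 d\<^sub>0' d\<^sub>1 d\<^sub>1' where d: "quasiderivation_with scale G br 0 d\<^sub>0 d\<^sub>0'"
      "quasiderivation_with scale G br 1 d\<^sub>1 d\<^sub>1'" "y = d\<^sub>0 + d\<^sub>1" by blast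
    show ?case
    proof (cases "\<gamma> = 0")
      case 0: True
      then show ?thesis using quasiderivation_with_add[OF x[unfolded 0] d(1)] d(2,3)
        by (metis add.assoc)
    next
      case False
      then have 1: "\<gamma> = 1" by simp
      then show ?thesis using quasiderivation_with_add[OF x[unfolded 1] d(2)] d(1,3)
        by (metis add.left_commute)
    qed
  qed
  with that show ?thesis by blast
qed

lemma proj_along_eq:
  assumes U: "direct_sum scale UNIV A U" and "b \<in> A" "u \<in> U"
  shows "proj_along A U (b + u) = b"
  unfolding proj_along_def
proof (rule the_equality)
  fix a assume a: "a \<in> A \<and> b + u - a \<in> U"
  have "subspace U" "subspace A" using U by (auto simp: direct_sum_def)
  then have "(b + u - a) - u \<in> U" "b - a \<in> A"
    using a assms(2,3) subspace_diff by blast+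
  then have "b - a \<in> A \<inter> U" by (simp add: algebra_simps)
  then have "b - a = 0" using U unfolding direct_sum_def by blast
  then show "a = b" by simp
qed (use assms in auto)

lemma proj_along_mem:
  assumes U: "direct_sum scale UNIV A U"
  shows "proj_along A U c \<in> A"
proof -
  have "c \<in> {a + u | a u. a \<in> A \<and> u \<in> U}" using U by (simp add: direct_sum_def)
  then obtain a u where "a \<in> A" "u \<in> U" "c = a + u" by blast
  with proj_along_eq[OF U] show ?thesis by simp
qed

lemma phi_eq:
  assumes U: "direct_sum scale UNIV (derived scale br) U"
    and d: "quasiderivation_with scale G br 0 d\<^sub>0 d\<^sub>0'" "quasiderivation_with scale G br 1 d\<^sub>1 d\<^sub>1'"
  shows "phi scale G br U (d\<^sub>0 + d\<^sub>1) = phi_hom scale br U d\<^sub>0 d\<^sub>0' + phi_hom scale br U d\<^sub>1 d\<^sub>1'"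
  unfolding phi_def
proof (rule the_equality)
  fix F assume "\<exists>e\<^sub>0 e\<^sub>0' e\<^sub>1 e\<^sub>1'. quasiderivation_with scale G br 0 e\<^sub>0 e\<^sub>0' \<and>
    quasiderivation_with scale G br 1 e\<^sub>1 e\<^sub>1' \<and> d\<^sub>0 + d\<^sub>1 = e\<^sub>0 + e\<^sub>1 \<and>
    F = phi_hom scale br U e\<^sub>0 e\<^sub>0' + phi_hom scale br U e\<^sub>1 e\<^sub>1'"
  then obtain e\<^sub>0 e\<^sub>0' e\<^sub>1 e\<^sub>1' where
    e: "quasiderivation_with scale G br 0 e\<^sub>0 e\<^sub>0'" "quasiderivation_with scale G br 1 e\<^sub>1 e\<^sub>1'"
    and eq: "d\<^sub>0 + d\<^sub>1 = e\<^sub>0 + e\<^sub>1"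
    and F: "F = phi_hom scale br U e\<^sub>0 e\<^sub>0' + phi_hom scale br U e\<^sub>1 e\<^sub>1'" by blast
  have eqs: "e\<^sub>0 = d\<^sub>0" "e\<^sub>1 = d\<^sub>1"
    using homogeneous_decomp_unique[OF _ _ _ _ eq] d e by (auto simp: quasiderivation_with_def)
  show "F = phi_hom scale br U d\<^sub>0 d\<^sub>0' + phi_hom scale br U d\<^sub>1 d\<^sub>1'"
    using quasiderivation_with_unique[OF e(1)[unfolded eqs] d(1) proj_along_mem[OF U]]
      quasiderivation_with_unique[OF e(2)[unfolded eqs] d(2) proj_along_mem[OF U]]
    by (simp add: F eqs phi_hom_def fun_eq_iff)
qed (use d in blast)

lemma phi_homogeneous:
  assumes U: "direct_sum scale UNIV (derived scale br) U"
    and d: "quasiderivation_with scale G br \<gamma> d d'"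
    and b: "b \<in> derived scale br" and u: "u \<in> U"
  shows "phi scale G br U d (a, b + u) = (d a, d' b)"
proof (cases "\<gamma> = 0")
  case 0: True
  show ?thesis
    using phi_eq[OF U d[unfolded 0] quasiderivation_with_0] proj_along_eq[OF U b u]
    by (simp add: phi_hom_def)
next
  case False
  then have 1: "\<gamma> = 1" by simp
  show ?thesis
    using phi_eq[OF U quasiderivation_with_0 d[unfolded 1]] proj_along_eq[OF U b u]
    by (simp add: phi_hom_def)
qed

lemma phi_linear:
  assumes U: "direct_sum scale UNIV (derived scale br) U"
    and "d \<in> QDer scale G br" "e \<in> QDer scale G br"
  shows "phi scale G br U (d + e) = phi scale G br U d + phi scale G br U e"
    and "phi scale G br U (fun_scale scale c d) =
      fun_scale (breve_scale scale) c (phi scale G br U d)"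
proof -
  obtain d\<^sub>0 d\<^sub>0' d\<^sub>1 d\<^sub>1' where d: "quasiderivation_with scale G br 0 d\<^sub>0 d\<^sub>0'"
    "quasiderivation_with scale G br 1 d\<^sub>1 d\<^sub>1'" "d = d\<^sub>0 + d\<^sub>1" using QDer_decomp assms(2) .
  obtain e\<^sub>0 e\<^sub>0' e\<^sub>1 e\<^sub>1' where e: "quasiderivation_with scale G br 0 e\<^sub>0 e\<^sub>0'"
    "quasiderivation_with scale G br 1 e\<^sub>1 e\<^sub>1'" "e = e\<^sub>0 + e\<^sub>1" using QDer_decomp assms(3) .
  have "d + e = (d\<^sub>0 + e\<^sub>0) + (d\<^sub>1 + e\<^sub>1)" by (simp add: d(3) e(3) algebra_simps)
  then show "phi scale G br U (d + e) = phi scale G br U d + phi scale G br U e"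
    using phi_eq[OF U quasiderivation_with_add[OF d(1) e(1)] quasiderivation_with_add[OF d(2) e(2)]]
      phi_eq[OF U d(1,2)] phi_eq[OF U e(1,2)]
    by (auto simp: d(3) e(3) phi_hom_def fun_eq_iff algebra_simps)
  have "fun_scale scale c d = fun_scale scale c d\<^sub>0 + fun_scale scale c d\<^sub>1"
    by (simp add: d(3) fs.scale_right_distrib)
  then have "phi scale G br U (fun_scale scale c d) =
      phi_hom scale br U (fun_scale scale c d\<^sub>0) (fun_scale scale c d\<^sub>0') +
      phi_hom scale br U (fun_scale scale c d\<^sub>1) (fun_scale scale c d\<^sub>1')"
    using phi_eq[OF U quasiderivation_with_scale[OF d(1)] quasiderivation_with_scale[OF d(2)]]
    by simp
  also have "\<dots> = fun_scale (breve_scale scale) c (phi scale G br U d)"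
    unfolding d(3) phi_eq[OF U d(1,2)]
    by (auto simp: phi_hom_def fun_eq_iff fun_scale_def breve_scale_def scale_right_distrib
        module_prod.scale_def module_prod_def module_pair_def module_axioms)
  finally show "phi scale G br U (fun_scale scale c d) =
      fun_scale (breve_scale scale) c (phi scale G br U d)" .
qed

end

end

(* Write a homogeneous derivation of the truncated algebra as a 2x2 block matrix with respect to
   gt and gt^2. Bracketing with gt^2 is zero, so the block from gt^2 to gt has values in the
   center of g and vanishes. What is left of the derivation rule says that the two diagonal blocks
   are a quasiderivation of g and an associated map, and compatibility only sees the first of them.
   After subtracting the image of this quasiderivation under phi, the values lie in gt^2 and
   [g,g]t^2 is mapped to 0, which is to say that the rest is a center derivation. Conversely the
   values of a center derivation lie in gt^2 because g has trivial center, hence it is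
   compatible, and it can only agree with phi(d) if d = 0. *)
theory Submission
  imports Defs
begin

context omega_lie_superalgebra
begin

section \<open>Linear structure on the truncated algebra and on its endomorphisms\<close>

lemma breve_scale_Pair [simp]: "breve_scale scale c (x, y) = (c *s x, c *s y)"
  by (simp add: breve_scale_def module_prod.scale_def module_prod_def module_pair_def module_axioms)

lemma vector_space_breve: "vector_space (breve_scale scale)"
  by unfold_locales
    (auto simp: scale_right_distrib scale_left_distrib)

text \<open>The ambient space of the direct sum: it gives spans and subspaces of endomorphisms of
  the truncated algebra under the prefix \<open>fb\<close>, next to \<open>fs\<close> for
  endomorphisms of g.\<close>

sublocale fb: vector_space
  "fun_scale (breve_scale scale) :: 'k \<Rightarrow> ('v \<times> 'v \<Rightarrow> 'v \<times> 'v) \<Rightarrow> 'v \<times> 'v \<Rightarrow> 'v \<times> 'v"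
  by unfold_locales
    (auto simp: fun_scale_def fun_eq_iff scale_right_distrib scale_left_distrib
      vector_space.vector_space_assms[OF vector_space_breve])

lemma br_zero [simp]: "br 0 x = 0" "br x 0 = 0"
  using br_scale(1)[of 0] br_scale(2)[of _ 0] by auto

lemma om_zero [simp]: "om 0 x = 0" "om x 0 = 0"
  using om_linear_left[of x] om_linear_right[of x]
  by (auto simp: Vector_Spaces.linear_iff dest!: spec[of _ 0])

section \<open>The graded projection onto [g,g] along U\<close>

text \<open>Splitting both arguments of a bracket by degree gives four homogeneous brackets. Since 1
  + 1 = 0 in \<open>bit\<close>, those of arguments of equal degree are even and the two mixed ones
  are odd, so the span of all brackets is graded.\<close>

lemma derived_graded_decomp:
  assumes "b \<in> derived scale br"
  obtains b\<^sub>0 b\<^sub>1 where "b\<^sub>0 \<in> derived scale br \<inter> G 0" "b\<^sub>1 \<in> derived scale br \<inter> G 1" "b = b\<^sub>0 + b\<^sub>1"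
proof -
  let ?D = "derived scale br"
  have D: "subspace ?D" by (simp add: derived_def)
  have br: "br x y \<in> ?D" for x y unfolding derived_def by (rule span_base) blast
  have "\<exists>b\<^sub>0 b\<^sub>1. b\<^sub>0 \<in> ?D \<inter> G 0 \<and> b\<^sub>1 \<in> ?D \<inter> G 1 \<and> b = b\<^sub>0 + b\<^sub>1"
    using assms unfolding derived_def
  proof (induction rule: span_induct_alt)
    case base
    show ?case using subspace_0[OF sub_G] span_zero by (intro exI[of _ 0]) auto
  next
    case (step c z w)
    then obtain x y where z: "z = br x y" by blast
    obtain x\<^sub>0 x\<^sub>1 where x: "x\<^sub>0 \<in> G 0" "x\<^sub>1 \<in> G 1" "x = x\<^sub>0 + x\<^sub>1" by (rule G_split)
    obtain y\<^sub>0 y\<^sub>1 where y: "y\<^sub>0 \<in> G 0" "y\<^sub>1 \<in> G 1" "y = y\<^sub>0 + y\<^sub>1" by (rule G_split)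
    from step obtain b\<^sub>0 b\<^sub>1 where w: "b\<^sub>0 \<in> ?D \<inter> G 0" "b\<^sub>1 \<in> ?D \<inter> G 1" "w = b\<^sub>0 + b\<^sub>1"
      unfolding derived_def by blast
    have "br x\<^sub>0 y\<^sub>0 \<in> G 0" "br x\<^sub>1 y\<^sub>1 \<in> G 0" "br x\<^sub>0 y\<^sub>1 \<in> G 1" "br x\<^sub>1 y\<^sub>0 \<in> G 1"
      using br_graded[OF x(1) y(1)] br_graded[OF x(2) y(2)] br_graded[OF x(1) y(2)]
        br_graded[OF x(2) y(1)] by simp_all
    then have "c *s (br x\<^sub>0 y\<^sub>0 + br x\<^sub>1 y\<^sub>1) + b\<^sub>0 \<in> ?D \<inter> G 0"
      "c *s (br x\<^sub>0 y\<^sub>1 + br x\<^sub>1 y\<^sub>0) + b\<^sub>1 \<in> ?D \<inter> G 1"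
      using w br D sub_G by (auto intro!: subspace_add subspace_scale)
    moreover have "c *s z + w = (c *s (br x\<^sub>0 y\<^sub>0 + br x\<^sub>1 y\<^sub>1) + b\<^sub>0) + (c *s (br x\<^sub>0 y\<^sub>1 + br x\<^sub>1 y\<^sub>0) + b\<^sub>1)"
      by (simp add: z w(3) x(3) y(3) br_add scale_right_distrib)
    ultimately show ?case unfolding derived_def by blast
  qed
  with that show ?thesis by blast
qed

lemma direct_sum_split:
  assumes "direct_sum scale UNIV A U"
  obtains b u where "b \<in> A" "u \<in> U" "c = b + u"
proof -
  have "c \<in> {a + u | a u. a \<in> A \<and> u \<in> U}" using assms by (simp add: direct_sum_def)
  with that show ?thesis by blast
qed

text \<open>Sums and multiples of decompositions along A and U are again such decompositions, and
  \<open>proj_along_eq\<close> reads off their first summands.\<close>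

lemma proj_along_linear:
  assumes "direct_sum scale UNIV A U"
  shows "proj_along A U (x + y) = proj_along A U x + proj_along A U y"
    and "proj_along A U (c *s x) = c *s proj_along A U x"
proof -
  have sub: "subspace A" "subspace U" using assms by (auto simp: direct_sum_def)
  obtain b u where x: "b \<in> A" "u \<in> U" "x = b + u" using direct_sum_split[OF assms] .
  obtain b' u' where y: "b' \<in> A" "u' \<in> U" "y = b' + u'" using direct_sum_split[OF assms] .
  have eq: "x + y = (b + b') + (u + u')" "c *s x = c *s b + c *s u"
    by (simp_all add: x(3) y(3) algebra_simps scale_right_distrib)
  show "proj_along A U (x + y) = proj_along A U x + proj_along A U y"
    unfolding eq using x y by (simp add: proj_along_eq[OF assms] sub subspace_add)
  show "proj_along A U (c *s x) = c *s proj_along A U x"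
    unfolding eq using x by (simp add: proj_along_eq[OF assms] sub subspace_scale)
qed

text \<open>Both [g,g] and U are graded, so splitting the two summands of c by degree also splits c.
  If c is homogeneous, the part in the other degree vanishes, and the remaining part exhibits a
  homogeneous first summand. This makes \<open>phi_hom\<close> homogeneous.\<close>

lemma proj_along_graded:
  assumes U: "direct_sum scale UNIV (derived scale br) U" and g: "graded_subspace scale G U"
    and c: "c \<in> G \<alpha>"
  shows "proj_along (derived scale br) U c \<in> G \<alpha>"
proof -
  obtain b u where bu: "b \<in> derived scale br" "u \<in> U" "c = b + u" using direct_sum_split[OF U] .
  obtain b\<^sub>0 b\<^sub>1 where b: "b\<^sub>0 \<in> derived scale br \<inter> G 0" "b\<^sub>1 \<in> derived scale br \<inter> G 1" "b = b\<^sub>0 + b\<^sub>1"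
    using derived_graded_decomp[OF bu(1)] .
  have "u \<in> {u + v | u v. u \<in> U \<inter> G 0 \<and> v \<in> U \<inter> G 1}"
    using g bu(2) unfolding graded_subspace_def by blast
  then obtain u\<^sub>0 u\<^sub>1 where u: "u\<^sub>0 \<in> U \<inter> G 0" "u\<^sub>1 \<in> U \<inter> G 1" "u = u\<^sub>0 + u\<^sub>1" by blast
  have eq: "(b\<^sub>0 + u\<^sub>0) + (b\<^sub>1 + u\<^sub>1) = c" by (simp add: bu b u algebra_simps)
  have mem: "b\<^sub>0 + u\<^sub>0 \<in> G 0" "b\<^sub>1 + u\<^sub>1 \<in> G 1" using b u sub_G subspace_add by auto
  show ?thesis
  proof (cases "\<alpha> = 0")
    case True
    then have "c \<in> G 0" using c by blast
    \<comment> \<open>Compare with the trivial splitting c + 0 into an even and an odd part.\<close>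
    then have "b\<^sub>0 + u\<^sub>0 = c"
      using G_cancel[OF mem _ subspace_0[OF sub_G], of c] eq by simp
    moreover have "proj_along (derived scale br) U (b\<^sub>0 + u\<^sub>0) = b\<^sub>0"
      using proj_along_eq[OF U] b u by blast
    ultimately show ?thesis using b True by simp
  next
    case False
    then have 1: "\<alpha> = 1" by simp
    then have "c \<in> G 1" using c by blast
    then have "b\<^sub>1 + u\<^sub>1 = c"
      using G_cancel[OF mem subspace_0[OF sub_G], of c] eq by simp
    moreover have "proj_along (derived scale br) U (b\<^sub>1 + u\<^sub>1) = b\<^sub>1"
      using proj_along_eq[OF U] b u by blast
    ultimately show ?thesis using b 1 by simp
  qed
qed

section \<open>Center derivations of the truncated algebra\<close>

lemma breve_split:
  obtains p\<^sub>0 p\<^sub>1 where "p\<^sub>0 \<in> breve_grading G 0" "p\<^sub>1 \<in> breve_grading G 1" "p = p\<^sub>0 + p\<^sub>1"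
proof -
  obtain x y where p: "p = (x, y)" by (cases p)
  obtain x\<^sub>0 x\<^sub>1 where x: "x\<^sub>0 \<in> G 0" "x\<^sub>1 \<in> G 1" "x = x\<^sub>0 + x\<^sub>1" by (rule G_split)
  obtain y\<^sub>0 y\<^sub>1 where y: "y\<^sub>0 \<in> G 0" "y\<^sub>1 \<in> G 1" "y = y\<^sub>0 + y\<^sub>1" by (rule G_split)
  show ?thesis using that[of "(x\<^sub>0, y\<^sub>0)" "(x\<^sub>1, y\<^sub>1)"] x y p by (auto simp: breve_grading_def)
qed

lemma breve_linear_iff: "Vector_Spaces.linear (breve_scale scale) (breve_scale scale) f \<longleftrightarrow>
    (\<forall>p q. f (p + q) = f p + f q) \<and> (\<forall>c p. f (breve_scale scale c p) = breve_scale scale c (f p))"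
  by (auto simp: Vector_Spaces.linear_iff vector_space_breve)

text \<open>Bracketing d(p) with yt leaves the bracket of \<open>fst (d p)\<close> with y, so for
  homogeneous p this component is central in g and hence 0. Additivity extends this to all
  p.\<close>

lemma center_derivation_fst:
  assumes Z: "center br = {0}"
    and d: "center_derivation (breve_scale scale) (breve_grading G) (breve_br br) \<gamma> d"
  shows "fst (d p) = 0"
proof -
  have lin: "d (p + q) = d p + d q" for p q
    using d unfolding center_derivation_def homogeneous_map_def breve_linear_iff by blast
  have H: "fst (d p) = 0" if "p \<in> breve_grading G \<alpha>" for p \<alpha>
  proof -
    have "br (fst (d p)) y = 0" for y
      using d that by (auto simp: center_derivation_def breve_br_def zero_prod_def)
    then have "fst (d p) \<in> center br" by (simp add: center_def)
    then show ?thesis using Z by simp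
  qed
  show ?thesis by (rule breve_split[of p]) (simp add: lin H)
qed

lemma ZDer_fst:
  assumes Z: "center br = {0}"
    and "z \<in> ZDer (breve_scale scale) (breve_grading G) (breve_br br)"
  shows "fst (z p) = 0"
  using assms(2) unfolding ZDer_def
proof (induction rule: fb.span_induct_alt)
  case (step c x y)
  then have "fst (x p) = 0" using center_derivation_fst[OF Z] by blast
  then show ?case using step.IH by (cases "x p") (simp add: fun_scale_def)
qed simp

text \<open>\<open>breve_br\<close> and \<open>breve_om\<close> see only gt-components, and those of
  all values of d are 0. So every term in the derivation rule and in compatibility vanishes.\<close>

lemma center_derivation_imp_compatible_derivation:
  assumes Z: "center br = {0}"
    and d: "center_derivation (breve_scale scale) (breve_grading G) (breve_br br) \<gamma> d"
  shows "derivation (breve_scale scale) (breve_grading G) (breve_br br) \<gamma> d"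
    "compatible (breve_grading G) (breve_om om) \<gamma> d"
proof -
  have fst: "fst (d p) = 0" for p using center_derivation_fst[OF Z d] .
  show "derivation (breve_scale scale) (breve_grading G) (breve_br br) \<gamma> d"
    using d fst by (auto simp: center_derivation_def derivation_def breve_br_def zero_prod_def)
  show "compatible (breve_grading G) (breve_om om) \<gamma> d"
    using fst by (auto simp: compatible_def breve_om_def)
qed

section \<open>The images of quasiderivations under \<open>phi\<close>\<close>

text \<open>Replaces the definite description behind \<open>phi\<close> by the explicit formula, for
  any choice of the associated map: two choices agree on [g,g].\<close>

lemma phi_eq_phi_hom:
  assumes U: "direct_sum scale UNIV (derived scale br) U"
    and d: "quasiderivation_with scale G br \<gamma> d d'"
  shows "phi scale G br U d = phi_hom scale br U d d'"
proof
  fix p :: "'v \<times> 'v"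
  obtain a c where p: "p = (a, c)" by (cases p)
  obtain b u where c: "b \<in> derived scale br" "u \<in> U" "c = b + u" using direct_sum_split[OF U] .
  show "phi scale G br U d p = phi_hom scale br U d d' p"
    using phi_homogeneous[OF U d c(1,2)] proj_along_eq[OF U c(1,2)] by (simp add: p c phi_hom_def)
qed

text \<open>Brackets of the truncated algebra lie in [g,g]t^2, where the projection is the identity.
  There the derivation rule is the relation between \<open>d\<close> and \<open>d'\<close>.\<close>

lemma phi_hom_derivation:
  assumes U: "direct_sum scale UNIV (derived scale br) U" and g: "graded_subspace scale G U"
    and d: "quasiderivation_with scale G br \<gamma> d d'"
  shows "derivation (breve_scale scale) (breve_grading G) (breve_br br) \<gamma> (phi_hom scale br U d d')"
proof -
  have hom: "homogeneous_map scale G \<gamma> d" "homogeneous_map scale G \<gamma> d'"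
    using d by (auto simp: quasiderivation_with_def)
  have "br x y \<in> derived scale br" for x y unfolding derived_def by (rule span_base) blast
  then have "proj_along (derived scale br) U (br x y) = br x y" for x y
    using proj_along_eq[OF U, of "br x y" 0] U by (simp add: direct_sum_def subspace_0)
  \<comment> \<open>A bracket has gt-component 0, so \<open>phi_hom\<close> sends it to an element
    with gt-component \<open>d 0\<close>.\<close>
  moreover have "d 0 = 0"
    using homogeneous_map_linear(2)[OF hom(1), of 0] by simp
  moreover have "d (x + y) = d x + d y" "d' (x + y) = d' x + d' y" "d (c *s x) = c *s d x"
    "d' (c *s x) = c *s d' x" for x y c
    using hom homogeneous_map_linear by blast+
  moreover have "x \<in> G \<alpha> \<Longrightarrow> d x \<in> G (\<gamma> + \<alpha>)" "x \<in> G \<alpha> \<Longrightarrow> d' x \<in> G (\<gamma> + \<alpha>)"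
    "x \<in> G \<alpha> \<Longrightarrow> d' (br x y) = br (d x) y + ksign \<gamma> \<alpha> *s br x (d y)" for x y \<alpha>
    using d unfolding quasiderivation_with_def homogeneous_map_def by blast+
  ultimately show ?thesis
    unfolding derivation_def homogeneous_map_def breve_linear_iff phi_hom_def breve_br_def
      breve_grading_def
    by (simp add: proj_along_linear[OF U] proj_along_graded[OF U g] split: prod.splits
        del: add_bit_eq_xor plus_bit_def)
qed

lemma phi_hom_compatible:
  assumes "compatible G om \<gamma> d"
  shows "compatible (breve_grading G) (breve_om om) \<gamma> (phi_hom scale br U d d')"
  using assms by (auto simp: compatible_def breve_om_def breve_grading_def phi_hom_def)

lemma QDer_omega_subset_QDer: "QDer_omega scale G br om \<subseteq> QDer scale G br"
  unfolding QDer_omega_def QDer_def by (rule fs.span_mono) blast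

lemma phi_0:
  assumes U: "direct_sum scale UNIV (derived scale br) U"
  shows "phi scale G br U 0 = 0"
  by (simp add: phi_eq_phi_hom[OF U quasiderivation_with_0] phi_hom_def fun_eq_iff zero_prod_def)

text \<open>The gt-component recovers d, so \<open>phi\<close> is injective on \<open>QDer\<close>.
  This is what makes the intersection with \<open>ZDer\<close> trivial.\<close>

lemma fst_phi:
  assumes U: "direct_sum scale UNIV (derived scale br) U" and "d \<in> QDer scale G br"
  shows "fst (phi scale G br U d (a, c)) = d a"
proof -
  obtain d\<^sub>0 d\<^sub>0' d\<^sub>1 d\<^sub>1' where d: "quasiderivation_with scale G br 0 d\<^sub>0 d\<^sub>0'"
    "quasiderivation_with scale G br 1 d\<^sub>1 d\<^sub>1'" "d = d\<^sub>0 + d\<^sub>1" using QDer_decomp assms(2) .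
  show ?thesis by (simp add: d(3) phi_eq[OF U d(1,2)] phi_hom_def)
qed

text \<open>The linearity of \<open>phi\<close> is established on \<open>QDer\<close> only, so S has
  to lie there for the usual argument about images of subspaces.\<close>

lemma phi_image_subspace:
  assumes U: "direct_sum scale UNIV (derived scale br) U"
    and S: "fs.subspace S" "S \<subseteq> QDer scale G br"
  shows "fb.subspace (phi scale G br U ` S)"
proof (rule fb.subspaceI)
  show "0 \<in> phi scale G br U ` S" using phi_0[OF U] fs.subspace_0[OF S(1)] by (metis imageI)
next
  fix x y assume "x \<in> phi scale G br U ` S" "y \<in> phi scale G br U ` S"
  then obtain d e where "x = phi scale G br U d" "y = phi scale G br U e" "d \<in> S" "e \<in> S" by blast
  moreover from this have "phi scale G br U (d + e) = x + y"
    using phi_linear(1)[OF U, of d e] S(2) by blast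
  ultimately show "x + y \<in> phi scale G br U ` S" using fs.subspace_add[OF S(1)] by (metis imageI)
next
  fix c x assume "x \<in> phi scale G br U ` S"
  then obtain d where "x = phi scale G br U d" "d \<in> S" by blast
  moreover from this have "phi scale G br U (fun_scale scale c d) = fun_scale (breve_scale scale) c x"
    using phi_linear(2)[OF U, of d d] S(2) by blast
  ultimately show "fun_scale (breve_scale scale) c x \<in> phi scale G br U ` S"
    using fs.subspace_scale[OF S(1)] by (metis imageI)
qed

lemma phi_QDer_omega_subset:
  assumes U: "direct_sum scale UNIV (derived scale br) U" and g: "graded_subspace scale G U"
    and d: "d \<in> QDer_omega scale G br om"
  shows "phi scale G br U d \<in>
    Der_omega (breve_scale scale) (breve_grading G) (breve_br br) (breve_om om)"
proof -
  \<comment> \<open>Membership of \<open>d\<close> in \<open>QDer\<close> is carried through the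
    induction, because \<open>phi_linear\<close> requires it of both summands.\<close>
  have "phi scale G br U d \<in>
      Der_omega (breve_scale scale) (breve_grading G) (breve_br br) (breve_om om) \<and>
    d \<in> QDer scale G br"
    using d unfolding QDer_omega_def
  proof (induction rule: fs.span_induct_alt)
    case base
    show ?case using fb.span_zero fs.span_zero by (simp only: Der_omega_def QDer_def phi_0[OF U])
  next
    case (step c x y)
    then obtain \<gamma> x' where x: "quasiderivation_with scale G br \<gamma> x x'" "compatible G om \<gamma> x"
      by (auto simp: quasiderivation_def)
    have "phi scale G br U x \<in>
      Der_omega (breve_scale scale) (breve_grading G) (breve_br br) (breve_om om)"
      unfolding Der_omega_def phi_eq_phi_hom[OF U x(1)]
      using phi_hom_derivation[OF U g x(1)] phi_hom_compatible[OF x(2)] by (blast intro: fb.span_base)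
    moreover have xq: "x \<in> QDer scale G br"
      unfolding QDer_def using x(1) by (auto intro!: fs.span_base simp: quasiderivation_def)
    moreover have cx: "fun_scale scale c x \<in> QDer scale G br"
      using xq unfolding QDer_def by (rule fs.span_scale)
    ultimately show ?case
      using step.IH
      by (simp only: phi_linear(1)[OF U cx] phi_linear(2)[OF U xq xq])
        (simp only: Der_omega_def QDer_def fb.span_add fb.span_scale fs.span_add)
  qed
  then show ?thesis ..
qed

section \<open>Splitting a compatible homogeneous derivation\<close>

text \<open>Here \<open>d\<close> is the block from gt to gt and \<open>d'\<close> the block from
  gt^2 to gt^2. The block from gt to gt^2 does not enter the derivation rule and survives in the
  center derivation.\<close>

lemma compatible_derivation_decomp:
  assumes Z: "center br = {0}"
    and U: "direct_sum scale UNIV (derived scale br) U" and g: "graded_subspace scale G U"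
    and der: "derivation (breve_scale scale) (breve_grading G) (breve_br br) \<gamma> D"
    and comp: "compatible (breve_grading G) (breve_om om) \<gamma> D"
  obtains d d' where "quasiderivation_with scale G br \<gamma> d d'" "compatible G om \<gamma> d"
    "center_derivation (breve_scale scale) (breve_grading G) (breve_br br) \<gamma>
      (D - phi_hom scale br U d d')"
proof -
  have add: "D (p + q) = D p + D q"
    and scale: "D (breve_scale scale c p) = breve_scale scale c (D p)"
    and hom: "p \<in> breve_grading G \<alpha> \<Longrightarrow> D p \<in> breve_grading G (\<gamma> + \<alpha>)" for p q c \<alpha>
    using der unfolding derivation_def homogeneous_map_def breve_linear_iff by blast+
  have leibniz: "D (0, br (fst p) (fst q)) =
      (0, br (fst (D p)) (fst q) + ksign \<gamma> \<alpha> *s br (fst p) (fst (D q)))"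
    if "p \<in> breve_grading G \<alpha>" for p q \<alpha>
  proof -
    have "D (breve_br br p q) = breve_br br (D p) q + breve_scale scale (ksign \<gamma> \<alpha>) (breve_br br p (D q))"
      using der that unfolding derivation_def by blast
    then show ?thesis by (simp add: breve_br_def)
  qed
  have D0: "D (0, 0) = (0, 0)" using scale[of 0 "(0, 0)"] by (cases "D (0, 0)") simp
  have G0: "0 \<in> G \<alpha>" for \<alpha> using subspace_0[OF sub_G] .
  \<comment> \<open>Apply the rule to at^2 and yt: their bracket is 0, and so is the term in which D
    acts on yt. What remains says that the gt-component of D(at^2) commutes with every y.\<close>
  have "fst (D (0, a)) = 0" if "a \<in> G \<alpha>" for a \<alpha>
  proof -
    have "br (fst (D (0, a))) y = 0" for y
      using leibniz[of "(0, a)" \<alpha> "(y, 0)"] that G0 D0 by (simp add: breve_grading_def)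
    then have "fst (D (0, a)) \<in> center br" by (simp add: center_def)
    then show ?thesis using Z by simp
  qed
  note H = this
  have h: "fst (D (0, a)) = 0" for a
  proof (rule G_split[of a])
    fix a\<^sub>0 a\<^sub>1 assume a: "a\<^sub>0 \<in> G 0" "a\<^sub>1 \<in> G 1" "a = a\<^sub>0 + a\<^sub>1"
    then show ?thesis using add[of "(0, a\<^sub>0)" "(0, a\<^sub>1)"] H by simp
  qed
  define d where "d x = fst (D (x, 0))" for x
  define d' where "d' y = snd (D (0, y))" for y
  have fst_D: "fst (D (x, y)) = d x" for x y
    using add[of "(x, 0)" "(0, y)"] h[of y] by (simp add: d_def)
  have D_t2: "D (0, y) = (0, d' y)" for y
    using h[of y] by (simp add: d'_def prod_eq_iff)
  have homd: "homogeneous_map scale G \<gamma> d"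
    unfolding homogeneous_map_def linear_iff
  proof (intro conjI allI ballI)
    show "d (x + y) = d x + d y" for x y using add[of "(x, 0)" "(y, 0)"] by (simp add: d_def)
    show "d (c *s x) = c *s d x" for c x
      using scale[of c "(x, 0)"] by (cases "D (x, 0)") (simp add: d_def)
    show "d x \<in> G (\<gamma> + \<alpha>)" if "x \<in> G \<alpha>" for x \<alpha>
      using hom[of "(x, 0)" \<alpha>] that G0 by (auto simp: d_def breve_grading_def mem_Times_iff)
  qed
  have homd': "homogeneous_map scale G \<gamma> d'"
    unfolding homogeneous_map_def linear_iff
  proof (intro conjI allI ballI)
    show "d' (x + y) = d' x + d' y" for x y using add[of "(0, x)" "(0, y)"] by (simp add: d'_def)
    show "d' (c *s x) = c *s d' x" for c x
      using scale[of c "(0, x)"] by (cases "D (0, x)") (simp add: d'_def)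
    show "d' x \<in> G (\<gamma> + \<alpha>)" if "x \<in> G \<alpha>" for x \<alpha>
      using hom[of "(0, x)" \<alpha>] that G0 by (auto simp: d'_def breve_grading_def mem_Times_iff)
  qed
  \<comment> \<open>Compare the t^2-components in the derivation rule for xt and yt.\<close>
  have q: "quasiderivation_with scale G br \<gamma> d d'"
    unfolding quasiderivation_with_def
  proof (intro conjI allI ballI homd homd')
    show "d' (br x y) = br (d x) y + ksign \<gamma> \<alpha> *s br x (d y)" if "x \<in> G \<alpha>" for \<alpha> x y
      using leibniz[of "(x, 0)" \<alpha> "(y, 0)"] that G0 by (simp add: d_def d'_def breve_grading_def)
  qed
  have c: "compatible G om \<gamma> d"
    unfolding compatible_def
  proof (intro allI ballI)
    show "om (d x) y + ksign \<gamma> \<alpha> * om x (d y) = 0" if "x \<in> G \<alpha>" for \<alpha> x y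
    proof -
      have "(x, 0) \<in> breve_grading G \<alpha>" using that G0 by (simp add: breve_grading_def)
      then have "breve_om om (D (x, 0)) (y, 0) + ksign \<gamma> \<alpha> * breve_om om (x, 0) (D (y, 0)) = 0"
        using comp unfolding compatible_def by blast
      then show ?thesis by (simp add: breve_om_def d_def)
    qed
  qed
  let ?F = "phi_hom scale br U d d'"
  have derF: "derivation (breve_scale scale) (breve_grading G) (breve_br br) \<gamma> ?F"
    using phi_hom_derivation[OF U g q] .
  have "homogeneous_map (breve_scale scale) (breve_grading G) \<gamma> (D - ?F)"
  proof -
    have F: "?F (p + q) = ?F p + ?F q" "?F (breve_scale scale c p) = breve_scale scale c (?F p)"
      "p \<in> breve_grading G \<alpha> \<Longrightarrow> ?F p \<in> breve_grading G (\<gamma> + \<alpha>)" for p q c \<alpha>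
      using derF unfolding derivation_def homogeneous_map_def breve_linear_iff by blast+
    have "(D - ?F) (p + q) = (D - ?F) p + (D - ?F) q" for p q
      by (simp only: fun_diff_def add F) simp
    moreover have "(D - ?F) (breve_scale scale c p) = breve_scale scale c ((D - ?F) p)" for c p
      unfolding fun_diff_def scale F
      by (simp add: module.scale_right_diff_distrib[OF
            vector_space_breve[folded module_iff_vector_space]])
    moreover have "(D - ?F) p \<in> breve_grading G (\<gamma> + \<alpha>)" if "p \<in> breve_grading G \<alpha>" for p \<alpha>
      using hom[OF that] F(3)[OF that] subspace_diff[OF sub_G]
      unfolding fun_diff_def breve_grading_def mem_Times_iff fst_diff snd_diff by blast
    ultimately show ?thesis unfolding homogeneous_map_def breve_linear_iff by blast
  qed
  \<comment> \<open>Both maps have gt-component \<open>d\<close> of the first coordinate. Values in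
    gt^2 bracket to 0, the first condition on a center derivation.\<close>
  moreover have "fst ((D - ?F) p) = 0" for p
    by (cases p) (simp add: phi_hom_def fst_D)
  \<comment> \<open>The second condition: brackets are fixed by the projection, so both maps act on
    them by \<open>d'\<close>.\<close>
  moreover have "(D - ?F) (0, br x y) = 0" for x y
  proof -
    have "br x y \<in> derived scale br" unfolding derived_def by (rule span_base) blast
    then have "proj_along (derived scale br) U (br x y) = br x y"
      using proj_along_eq[OF U, of "br x y" 0] U by (simp add: direct_sum_def subspace_0)
    then show ?thesis
      using homogeneous_map_linear(2)[OF homd, of 0]
      by (simp add: phi_hom_def D_t2 zero_prod_def)
  qed
  ultimately have "center_derivation (breve_scale scale) (breve_grading G) (breve_br br) \<gamma> (D - ?F)"
    unfolding center_derivation_def breve_br_def by (simp add: zero_prod_def)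
  with q c that show ?thesis by blast
qed

section \<open>The direct sum decomposition of \<open>Der_omega\<close>\<close>

lemma direct_sum_Der_omega:
  assumes Z: "center br = {0}"
    and g: "graded_subspace scale G U" and U: "direct_sum scale UNIV (derived scale br) U"
  shows "direct_sum (fun_scale (breve_scale scale))
    (Der_omega (breve_scale scale) (breve_grading G) (breve_br br) (breve_om om))
    (phi scale G br U ` QDer_omega scale G br om)
    (ZDer (breve_scale scale) (breve_grading G) (breve_br br))"
    (is "direct_sum _ ?D ?Q ?Z")
proof -
  have Q: "fb.subspace ?Q"
    by (rule phi_image_subspace[OF U _ QDer_omega_subset_QDer]) (simp add: QDer_omega_def)
  have ZZ: "fb.subspace ?Z" by (simp add: ZDer_def)
  have D: "fb.subspace ?D" by (simp add: Der_omega_def)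
  have "?Z \<subseteq> ?D" unfolding ZDer_def Der_omega_def
    by (rule fb.span_mono) (use center_derivation_imp_compatible_derivation[OF Z] in blast)
  moreover have "?Q \<subseteq> ?D" using phi_QDer_omega_subset[OF U g] by blast
  ultimately have "{a + b | a b. a \<in> ?Q \<and> b \<in> ?Z} \<subseteq> ?D"
    using fb.subspace_add[OF D] by blast
  \<comment> \<open>The sum of two subspaces is a subspace, so it suffices to decompose the
    homogeneous generators of the span.\<close>
  moreover have "?D \<subseteq> {a + b | a b. a \<in> ?Q \<and> b \<in> ?Z}"
    unfolding Der_omega_def
  proof (rule fb.span_minimal[OF _ fb.subspace_sums[OF Q ZZ]], clarify)
    fix \<gamma> F
    assume "derivation (breve_scale scale) (breve_grading G) (breve_br br) \<gamma> F"
      "compatible (breve_grading G) (breve_om om) \<gamma> F"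
    then obtain d d' where q: "quasiderivation_with scale G br \<gamma> d d'" "compatible G om \<gamma> d"
      and z: "center_derivation (breve_scale scale) (breve_grading G) (breve_br br) \<gamma>
        (F - phi_hom scale br U d d')"
      using compatible_derivation_decomp[OF Z U g] by blast
    have "d \<in> QDer_omega scale G br om" unfolding QDer_omega_def
      using q by (auto intro!: fs.span_base simp: quasiderivation_def)
    then have "phi_hom scale br U d d' \<in> ?Q" using phi_eq_phi_hom[OF U q(1)] by (metis imageI)
    moreover have "F - phi_hom scale br U d d' \<in> ?Z"
      unfolding ZDer_def using z by (blast intro: fb.span_base)
    moreover have "F = phi_hom scale br U d d' + (F - phi_hom scale br U d d')" by simp
    ultimately show "\<exists>a b. F = a + b \<and> a \<in> ?Q \<and> b \<in> ?Z" by blast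
  qed
  moreover have "?Q \<inter> ?Z \<subseteq> {0}"
  proof clarify
    fix d assume d: "d \<in> QDer_omega scale G br om" and z: "phi scale G br U d \<in> ?Z"
    \<comment> \<open>Evaluate at the element at: its image has gt-component \<open>d a\<close> by
      \<open>fst_phi\<close> and 0 by \<open>ZDer_fst\<close>.\<close>
    have "d a = 0" for a
      using fst_phi[OF U, of d a 0] ZDer_fst[OF Z z] QDer_omega_subset_QDer d by auto
    then have "d = 0" by auto
    then show "phi scale G br U d = 0" using phi_0[OF U] by simp
  qed
  ultimately show ?thesis
    using Q ZZ fb.subspace_0[OF Q] fb.subspace_0[OF ZZ] unfolding direct_sum_def by blast
qed

end

theorem theorem4p4:
  fixes scale :: "'k::field_char_0 \<Rightarrow> 'v::ab_group_add \<Rightarrow> 'v"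
    and G :: "bit \<Rightarrow> 'v set"
    and br :: "'v \<Rightarrow> 'v \<Rightarrow> 'v"
    and om :: "'v \<Rightarrow> 'v \<Rightarrow> 'k"
    and U :: "'v set"
  assumes "omega_lie_superalgebra scale G br om"
    and "center br = {0}"
    and "graded_subspace scale G U"
    and "direct_sum scale UNIV (derived scale br) U"
  shows "direct_sum (fun_scale (breve_scale scale))
    (Der_omega (breve_scale scale) (breve_grading G) (breve_br br) (breve_om om))
    (phi scale G br U ` QDer_omega scale G br om)
    (ZDer (breve_scale scale) (breve_grading G) (breve_br br))"
  using omega_lie_superalgebra.direct_sum_Der_omega[OF assms] .

end
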